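(* Let $\mathsf{T}$ and $\mathsf{S}$ be locally small categories with $\mathsf{S}$ well-powered, let $\mathcal{I}\colon\mathsf{T}\to\mathsf{S}$ be a functor, and let $\triangle$ be an object of $\mathsf{T}$. Assume that $\mathsf{S}$ has equalisers of pairs of parallel arrows and intersections of arbitrary families of subobjects. Then for any object $t$ of $\mathsf{T}$, any relation $R$ on $\hom_{\mathsf{T}}(t,\triangle)$, and any $\mathsf{S}$-subobject $s\colon\mathrm{dom}\,s\to\mathcal{I}(t)$, we have $$R\subseteq\mathbb{C}(s)\quad\text{if, and only if,}\quad s\leq\mathbb{V}(R).$$
   Context: For a subobject $s\colon\mathrm{dom}\,s\to\mathcal{I}(t)$, $\mathbb{C}(s):=\{(p,q)\in\hom_{\mathsf{T}}(t,\triangle)^2\mid\mathcal{I}(p)\circ s=\mathcal{I}(q)\circ s\}$. For a binary relation $R$ on $\hom_{\mathsf{T}}(t,\triangle)$, $\mathbb{V}(R):=\bigwedge_{(p,q)\in R}\mathrm{Eq}(\mathcal{I}(p),\mathcal{I}(q))$, the intersection of the subobjects of $\mathcal{I}(t)$ given by the equalisers of $\mathcal{I}(p),\mathcal{I}(q)\colon\mathcal{I}(t)\rightrightarrows\mathcal{I}(\triangle)$. The symbol $\leq$ denotes the usual order on subobjects: $x\leq y$ if there is $m\colon\mathrm{dom}\,x\to\mathrm{dom}\,y$ with $x=y\circ m$. *)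

theory Defs
  imports Main "HOL-Library.Equipollence"
begin

record ('o, 'a) cat =
  Obj :: "'o set"
  Arr :: "'a set"
  Dom :: "'a \<Rightarrow> 'o"
  Cod :: "'a \<Rightarrow> 'o"
  Id :: "'o \<Rightarrow> 'a"
  Comp :: "'a \<Rightarrow> 'a \<Rightarrow> 'a"  (infixr "\<cdot>\<index>" 70)

definition Hom :: "('o, 'a) cat \<Rightarrow> 'o \<Rightarrow> 'o \<Rightarrow> 'a set" where
  "Hom C x y = {f \<in> Arr C. Dom C f = x \<and> Cod C f = y}"

text \<open>Composition is written in applicative order: \<open>g \<cdot> f\<close> is first \<open>f\<close>, then \<open>g\<close>.\<close>

locale category =
  fixes C :: "('o, 'a) cat" (structure)
  assumes Dom_Obj: "f \<in> Arr C \<Longrightarrow> Dom C f \<in> Obj C"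
    and Cod_Obj: "f \<in> Arr C \<Longrightarrow> Cod C f \<in> Obj C"
    and Id_Hom: "x \<in> Obj C \<Longrightarrow> Id C x \<in> Hom C x x"
    and Comp_Hom: "f \<in> Hom C x y \<Longrightarrow> g \<in> Hom C y z \<Longrightarrow> g \<cdot> f \<in> Hom C x z"
    and Comp_Id: "f \<in> Hom C x y \<Longrightarrow> f \<cdot> Id C x = f"
    and Id_Comp: "f \<in> Hom C x y \<Longrightarrow> Id C y \<cdot> f = f"
    and Comp_assoc: "f \<in> Hom C w x \<Longrightarrow> g \<in> Hom C x y \<Longrightarrow> h \<in> Hom C y z
      \<Longrightarrow> (h \<cdot> g) \<cdot> f = h \<cdot> (g \<cdot> f)"

record ('o, 'a, 'p, 'b) func =
  ObjMap :: "'o \<Rightarrow> 'p"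
  ArrMap :: "'a \<Rightarrow> 'b"

locale cat_functor = T: category T + S: category S
  for T :: "('o, 'a) cat" and S :: "('p, 'b) cat" +
  fixes F :: "('o, 'a, 'p, 'b) func"
  assumes ObjMap_Obj: "x \<in> Obj T \<Longrightarrow> ObjMap F x \<in> Obj S"
    and ArrMap_Hom: "f \<in> Hom T x y \<Longrightarrow> ArrMap F f \<in> Hom S (ObjMap F x) (ObjMap F y)"
    and ArrMap_Id: "x \<in> Obj T \<Longrightarrow> ArrMap F (Id T x) = Id S (ObjMap F x)"
    and ArrMap_Comp: "f \<in> Hom T x y \<Longrightarrow> g \<in> Hom T y z
      \<Longrightarrow> ArrMap F (g \<cdot>\<^bsub>T\<^esub> f) = ArrMap F g \<cdot>\<^bsub>S\<^esub> ArrMap F f"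

definition monic :: "('o, 'a) cat \<Rightarrow> 'a \<Rightarrow> bool" where
  "monic C m \<longleftrightarrow> m \<in> Arr C \<and>
    (\<forall>w. \<forall>f \<in> Hom C w (Dom C m). \<forall>g \<in> Hom C w (Dom C m). m \<cdot>\<^bsub>C\<^esub> f = m \<cdot>\<^bsub>C\<^esub> g \<longrightarrow> f = g)"

text \<open>A subobject is handled through a representing monomorphism; two monomorphisms
  represent the same subobject iff each is below the other in the order \<open>sub_le\<close>.\<close>

definition Sub :: "('o, 'a) cat \<Rightarrow> 'o \<Rightarrow> 'a set" where
  "Sub C x = {m. monic C m \<and> Cod C m = x}"

definition sub_le :: "('o, 'a) cat \<Rightarrow> 'a \<Rightarrow> 'a \<Rightarrow> bool" where
  "sub_le C x y \<longleftrightarrow> (\<exists>m \<in> Hom C (Dom C x) (Dom C y). x = y \<cdot>\<^bsub>C\<^esub> m)"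

definition is_equaliser :: "('o, 'a) cat \<Rightarrow> 'a \<Rightarrow> 'a \<Rightarrow> 'a \<Rightarrow> bool" where
  "is_equaliser C f g e \<longleftrightarrow>
    e \<in> Hom C (Dom C e) (Dom C f) \<and> f \<cdot>\<^bsub>C\<^esub> e = g \<cdot>\<^bsub>C\<^esub> e \<and>
    (\<forall>w. \<forall>h \<in> Hom C w (Dom C f). f \<cdot>\<^bsub>C\<^esub> h = g \<cdot>\<^bsub>C\<^esub> h
      \<longrightarrow> (\<exists>!k. k \<in> Hom C w (Dom C e) \<and> h = e \<cdot>\<^bsub>C\<^esub> k))"

definition has_equalisers :: "('o, 'a) cat \<Rightarrow> bool" where
  "has_equalisers C \<longleftrightarrow>
    (\<forall>x y. \<forall>f \<in> Hom C x y. \<forall>g \<in> Hom C x y. \<exists>e. is_equaliser C f g e)"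

definition is_intersection :: "('o, 'a) cat \<Rightarrow> 'o \<Rightarrow> 'a set \<Rightarrow> 'a \<Rightarrow> bool" where
  "is_intersection C x A m \<longleftrightarrow>
    m \<in> Sub C x \<and> (\<forall>a \<in> A. sub_le C m a) \<and>
    (\<forall>n \<in> Sub C x. (\<forall>a \<in> A. sub_le C n a) \<longrightarrow> sub_le C n m)"

text \<open>Size is measured against a type \<open>'u\<close>: a set is small if its cardinality is strictly
  below that of \<open>'u\<close>. When \<open>'u\<close> has inaccessible cardinality these are, up to bijection, the
  sets of a model of set theory, while collections of at least that cardinality play the role
  of proper classes. Nothing is assumed about \<open>'u\<close>.\<close>

definition small :: "'u itself \<Rightarrow> 'x set \<Rightarrow> bool" where
  "small (U :: 'u itself) A \<longleftrightarrow> A \<prec> (UNIV :: 'u set)"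

definition locally_small :: "'u itself \<Rightarrow> ('o, 'a) cat \<Rightarrow> bool" where
  "locally_small U C \<longleftrightarrow> (\<forall>x \<in> Obj C. \<forall>y \<in> Obj C. small U (Hom C x y))"

definition well_powered :: "'u itself \<Rightarrow> ('o, 'a) cat \<Rightarrow> bool" where
  "well_powered U C \<longleftrightarrow>
    (\<forall>x \<in> Obj C. \<exists>M \<subseteq> Sub C x. small U M \<and>
      (\<forall>s \<in> Sub C x. \<exists>m \<in> M. sub_le C s m \<and> sub_le C m s))"

definition has_intersections :: "'u itself \<Rightarrow> ('o, 'a) cat \<Rightarrow> bool" where
  "has_intersections U C \<longleftrightarrow>
    (\<forall>x \<in> Obj C. \<forall>A \<subseteq> Sub C x. small U A \<longrightarrow> (\<exists>m. is_intersection C x A m))"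

text \<open>Equalisers and intersections are determined only up to isomorphism;
  \<open>Eq\<close> and \<open>Meet\<close> select arbitrary ones.\<close>

definition Eq :: "('o, 'a) cat \<Rightarrow> 'a \<Rightarrow> 'a \<Rightarrow> 'a" where
  "Eq C f g = (SOME e. is_equaliser C f g e)"

definition Meet :: "('o, 'a) cat \<Rightarrow> 'o \<Rightarrow> 'a set \<Rightarrow> 'a" where
  "Meet C x A = (SOME m. is_intersection C x A m)"

definition CC :: "('o, 'a) cat \<Rightarrow> ('p, 'b) cat \<Rightarrow> ('o, 'a, 'p, 'b) func \<Rightarrow> 'o \<Rightarrow> 'o \<Rightarrow> 'b \<Rightarrow> ('a \<times> 'a) set"
  where
  "CC T S F d t s = {(p, q). p \<in> Hom T t d \<and> q \<in> Hom T t d \<and>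
    ArrMap F p \<cdot>\<^bsub>S\<^esub> s = ArrMap F q \<cdot>\<^bsub>S\<^esub> s}"

definition VV :: "('p, 'b) cat \<Rightarrow> ('o, 'a, 'p, 'b) func \<Rightarrow> 'o \<Rightarrow> ('a \<times> 'a) set \<Rightarrow> 'b" where
  "VV S F t R = Meet S (ObjMap F t) {Eq S (ArrMap F p) (ArrMap F q) | p q. (p, q) \<in> R}"

end

theory Submission imports Defs
begin

text \<open>For a pair \<open>(p, q)\<close>, the universal property of the equaliser says that \<open>s\<close> lies below
  \<open>Eq (\<I> p) (\<I> q)\<close> iff \<open>\<I> p \<cdot> s = \<I> q \<cdot> s\<close>, and \<open>s\<close> lies below an intersection iff it lies below
  each member. The one subtle point is that the intersection exists: nothing is assumed about the
  size type, so the family of equalisers indexed by \<open>R\<close> need not obviously be small. By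
  well-poweredness it can be replaced by a family of representatives taken from a small set.\<close>

lemma small_subset: "small U M \<Longrightarrow> A \<subseteq> M \<Longrightarrow> small U A"
  unfolding small_def by (rule lesspoll_trans1[OF subset_imp_lepoll])

context category
begin

lemma SubD: "m \<in> Sub C x \<Longrightarrow> m \<in> Hom C (Dom C m) x"
  by (simp add: Sub_def monic_def Hom_def)

text \<open>The factorising arrows compose; \<open>c \<in> Sub C x\<close> supplies the typing of
  \<open>c\<close> that associativity requires. This is what allows subobjects to be exchanged for
  equivalent ones.\<close>

lemma sub_le_trans:
  assumes "sub_le C a b" and "sub_le C b c" and "c \<in> Sub C x"
  shows "sub_le C a c"
proof -
  obtain m where m: "m \<in> Hom C (Dom C a) (Dom C b)" "a = b \<cdot> m"
    using assms(1) unfolding sub_le_def by blast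
  obtain n where n: "n \<in> Hom C (Dom C b) (Dom C c)" "b = c \<cdot> n"
    using assms(2) unfolding sub_le_def by blast
  have "a = c \<cdot> (n \<cdot> m)"
    using Comp_assoc[OF m(1) n(1) SubD[OF assms(3)]] m(2) n(2) by simp
  then show ?thesis
    unfolding sub_le_def using Comp_Hom[OF m(1) n(1)] by blast
qed

text \<open>Monicity comes from the uniqueness half of the universal property: if
  \<open>e \<cdot> a = e \<cdot> b\<close>, this arrow equalises \<open>f\<close> and
  \<open>g\<close>, and both \<open>a\<close> and \<open>b\<close> factor it through
  \<open>e\<close>.\<close>

lemma equaliser_Sub:
  assumes f: "f \<in> Hom C x y" and g: "g \<in> Hom C x y" and e: "is_equaliser C f g e"
  shows "e \<in> Sub C x"
proof -
  have x: "Dom C f = x" using f by (simp add: Hom_def)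
  have eH: "e \<in> Hom C (Dom C e) x" and fe: "f \<cdot> e = g \<cdot> e"
    and univ: "\<And>w h. h \<in> Hom C w x \<Longrightarrow> f \<cdot> h = g \<cdot> h
      \<Longrightarrow> \<exists>!k. k \<in> Hom C w (Dom C e) \<and> h = e \<cdot> k"
    using e unfolding is_equaliser_def x by blast+
  have "a = b" if a: "a \<in> Hom C w (Dom C e)" and b: "b \<in> Hom C w (Dom C e)"
    and ab: "e \<cdot> a = e \<cdot> b" for w a b
  proof -
    have "f \<cdot> (e \<cdot> a) = g \<cdot> (e \<cdot> a)"
      using Comp_assoc[OF a eH f] Comp_assoc[OF a eH g] fe by simp
    from univ[OF Comp_Hom[OF a eH] this] show ?thesis
      using a b ab by blast
  qed
  then show ?thesis
    using eH unfolding Sub_def monic_def Hom_def by blast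
qed

text \<open>Precomposing \<open>f \<cdot> e = g \<cdot> e\<close> with a factorisation of
  \<open>s\<close> through \<open>e\<close> gives one direction; the existence half of the universal
  property gives the other.\<close>

lemma sub_le_equaliser_iff:
  assumes f: "f \<in> Hom C x y" and g: "g \<in> Hom C x y" and e: "is_equaliser C f g e"
    and s: "s \<in> Sub C x"
  shows "sub_le C s e \<longleftrightarrow> f \<cdot> s = g \<cdot> s"
proof
  have eH: "e \<in> Hom C (Dom C e) x" and fe: "f \<cdot> e = g \<cdot> e"
    using SubD[OF equaliser_Sub[OF f g e]] e unfolding is_equaliser_def by blast+
  assume "sub_le C s e"
  then obtain m where m: "m \<in> Hom C (Dom C s) (Dom C e)" "s = e \<cdot> m"
    unfolding sub_le_def by blast
  then show "f \<cdot> s = g \<cdot> s"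
    using Comp_assoc[OF m(1) eH f] Comp_assoc[OF m(1) eH g] fe by simp
next
  have x: "Dom C f = x" using f by (simp add: Hom_def)
  assume "f \<cdot> s = g \<cdot> s"
  then show "sub_le C s e"
    using e SubD[OF s] unfolding is_equaliser_def x sub_le_def by blast
qed

lemma is_equaliser_Eq:
  assumes "has_equalisers C" and "f \<in> Hom C x y" and "g \<in> Hom C x y"
  shows "is_equaliser C f g (Eq C f g)"
  unfolding Eq_def by (rule someI_ex) (use assms in \<open>unfold has_equalisers_def, blast\<close>)

lemma is_intersection_Meet:
  assumes wp: "well_powered U C" and int: "has_intersections U C"
    and x: "x \<in> Obj C" and A: "A \<subseteq> Sub C x"
  shows "is_intersection C x A (Meet C x A)"
proof -
  obtain M where M: "M \<subseteq> Sub C x" "small U M"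
    and rep: "\<forall>s \<in> Sub C x. \<exists>m \<in> M. sub_le C s m \<and> sub_le C m s"
    using bspec[OF wp[unfolded well_powered_def] x] by (elim exE conjE) rule
  \<comment> \<open>All representatives equivalent to some member of \<open>A\<close> are kept, so
    none has to be chosen. Smallness of \<open>B\<close> follows from
    \<open>B \<subseteq> M\<close>, whatever the size of \<open>A\<close>.\<close>
  define B where "B = {m \<in> M. \<exists>a \<in> A. sub_le C a m \<and> sub_le C m a}"
  have B: "B \<subseteq> Sub C x" "small U B"
    using M small_subset[OF M(2)] by (auto simp: B_def)
  \<comment> \<open>Being an intersection depends on the family only through its lower bounds, so
    once these agree for \<open>A\<close> and \<open>B\<close>, an intersection of \<open>B\<close>
    is one of \<open>A\<close>.\<close>
  have same: "(\<forall>b \<in> B. sub_le C n b) \<longleftrightarrow> (\<forall>a \<in> A. sub_le C n a)" for n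
  proof
    assume n: "\<forall>b \<in> B. sub_le C n b"
    show "\<forall>a \<in> A. sub_le C n a"
    proof
      fix a assume a: "a \<in> A"
      then obtain b where "b \<in> M" "sub_le C a b" "sub_le C b a"
        using rep A by blast
      then have "sub_le C n b" "sub_le C b a" using n a by (auto simp: B_def)
      then show "sub_le C n a" using sub_le_trans a A by blast
    qed
  next
    assume n: "\<forall>a \<in> A. sub_le C n a"
    show "\<forall>b \<in> B. sub_le C n b"
    proof
      fix b assume b: "b \<in> B"
      then obtain a where "a \<in> A" "sub_le C a b" by (auto simp: B_def)
      then show "sub_le C n b" using sub_le_trans n b B(1) by blast
    qed
  qed
  obtain m where "is_intersection C x B m"
    using int x B unfolding has_intersections_def by blast
  then have "is_intersection C x A m"
    unfolding is_intersection_def same .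
  then show ?thesis
    unfolding Meet_def by (rule someI)
qed

text \<open>An intersection is a greatest lower bound: transitivity gives one direction, maximality
  the other.\<close>

lemma sub_le_intersection_iff:
  assumes m: "is_intersection C x A m" and A: "A \<subseteq> Sub C x" and s: "s \<in> Sub C x"
  shows "sub_le C s m \<longleftrightarrow> (\<forall>a \<in> A. sub_le C s a)"
proof
  have mS: "m \<in> Sub C x" and le: "\<And>a. a \<in> A \<Longrightarrow> sub_le C m a"
    using m unfolding is_intersection_def by blast+
  assume "sub_le C s m"
  then show "\<forall>a \<in> A. sub_le C s a"
    using sub_le_trans le A by blast
next
  assume "\<forall>a \<in> A. sub_le C s a"
  then show "sub_le C s m"
    using m s unfolding is_intersection_def by blast
qed

end

theorem lemma2p3:
  fixes T :: "('o, 'a) cat" and S :: "('p, 'b) cat"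
    and \<I> :: "('o, 'a, 'p, 'b) func"
    and U :: "'u itself"
    and \<Delta> t :: 'o and R :: "('a \<times> 'a) set" and s :: 'b
  assumes "category T" and "category S"
    and "locally_small U T" and "locally_small U S" and "well_powered U S"
    and "cat_functor T S \<I>"
    and "\<Delta> \<in> Obj T"
    and "has_equalisers S" and "has_intersections U S"
    and "t \<in> Obj T"
    and "R \<subseteq> Hom T t \<Delta> \<times> Hom T t \<Delta>"
    and "s \<in> Sub S (ObjMap \<I> t)"
  shows "R \<subseteq> CC T S \<I> \<Delta> t s \<longleftrightarrow> sub_le S s (VV S \<I> t R)"
proof -
  interpret cat_functor T S \<I> by fact
  let ?x = "ObjMap \<I> t"
  let ?E = "\<lambda>p q. Eq S (ArrMap \<I> p) (ArrMap \<I> q)"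
  let ?A = "{?E p q | p q. (p, q) \<in> R}"
  have hom: "ArrMap \<I> p \<in> Hom S ?x (ObjMap \<I> \<Delta>)" "ArrMap \<I> q \<in> Hom S ?x (ObjMap \<I> \<Delta>)"
    if "(p, q) \<in> R" for p q
    using that assms(11) ArrMap_Hom by blast+
  have eq: "is_equaliser S (ArrMap \<I> p) (ArrMap \<I> q) (?E p q)" if "(p, q) \<in> R" for p q
    using S.is_equaliser_Eq[OF \<open>has_equalisers S\<close> hom[OF that]] .
  have "?E p q \<in> Sub S ?x" if "(p, q) \<in> R" for p q
    using S.equaliser_Sub[OF hom[OF that] eq[OF that]] .
  then have A: "?A \<subseteq> Sub S ?x"
    by auto
  have "is_intersection S ?x ?A (VV S \<I> t R)"
    unfolding VV_def
    by (rule S.is_intersection_Meet[OF \<open>well_powered U S\<close> \<open>has_intersections U S\<close>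
          ObjMap_Obj[OF \<open>t \<in> Obj T\<close>] A])
  then have "sub_le S s (VV S \<I> t R) \<longleftrightarrow> (\<forall>a \<in> ?A. sub_le S s a)"
    using A assms(12) by (rule S.sub_le_intersection_iff)
  also have "\<dots> \<longleftrightarrow> (\<forall>(p, q) \<in> R. sub_le S s (?E p q))"
    by blast
  also have "\<dots> \<longleftrightarrow> (\<forall>(p, q) \<in> R. ArrMap \<I> p \<cdot>\<^bsub>S\<^esub> s = ArrMap \<I> q \<cdot>\<^bsub>S\<^esub> s)"
  proof -
    have "sub_le S s (?E p q) \<longleftrightarrow> ArrMap \<I> p \<cdot>\<^bsub>S\<^esub> s = ArrMap \<I> q \<cdot>\<^bsub>S\<^esub> s"
      if "(p, q) \<in> R" for p q
      using S.sub_le_equaliser_iff[OF hom[OF that] eq[OF that] assms(12)] .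
    then show ?thesis by auto
  qed
  \<comment> \<open>Membership in \<open>CC\<close> also demands that both arrows lie in
    \<open>Hom T t \<Delta>\<close>; this holds because \<open>R\<close> is a relation on that
    hom-set.\<close>
  also have "\<dots> \<longleftrightarrow> R \<subseteq> CC T S \<I> \<Delta> t s"
    using assms(11) unfolding CC_def by blast
  finally show ?thesis ..
qed

end
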